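(* Let $S$ be a non-singular complex projective surface and let $D$ be an effective divisor on $S$. Set $D^{(0)}=D$ and $D^{(k+1)}=\widetilde{D^{(k)}}$ for $k\ge 0$, where $\tilde{\ }$ denotes the isoparametric transform. Then there is an integer $N\ge 0$ such that $D^{(N)}$ is nef and $D^{(k)}=D^{(N)}$ for all $k\ge N$.
   Context: Divisors are integral divisors; a divisor is effective if it is a finite sum of irreducible curves with non-negative integer coefficients. For an effective divisor $D$ on $S$, let $\{D_i\}$ be the finite collection of irreducible curves with $D_i^2<0$ and $D\cdot D_i<0$. The isoparametric transform of $D$ is the divisor $$\tilde D = D - \sum_{i:\,D\cdot D_i<0}\left\lceil\frac{D_i\cdot D}{D_i^2}\right\rceil D_i ,$$ where $\lceil\cdot\rceil$ is the ceiling function. The divisor $\tilde D$ is again effective, so the transform can be iterated. A divisor is nef if it has non-negative intersection number with every irreducible curve on $S$. *)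

theory Defs
  imports "HOL-Analysis.Analysis" "HOL-Library.Poly_Mapping" "HOL-Library.Extended_Nat"
begin

text \<open>Points of the projective space of dimension \<open>CARD('n) - 1\<close>: nonzero vectors up to scaling.\<close>

quotient_type 'n proj =
  "complex ^ 'n" / partial: "\<lambda>x y. x \<noteq> 0 \<and> y \<noteq> 0 \<and> (\<exists>c. c \<noteq> 0 \<and> y = c *s x)"
proof (rule part_equivpI)
  show "\<exists>x::complex ^ 'n. x \<noteq> 0 \<and> x \<noteq> 0 \<and> (\<exists>c. c \<noteq> 0 \<and> x = c *s x)"
    by (rule exI[of _ 1], auto intro!: exI[of _ 1])
  show "symp (\<lambda>x y::complex ^ 'n. x \<noteq> 0 \<and> y \<noteq> 0 \<and> (\<exists>c. c \<noteq> 0 \<and> y = c *s x))"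
  proof (rule sympI)
    fix x y :: "complex ^ 'n"
    assume "x \<noteq> 0 \<and> y \<noteq> 0 \<and> (\<exists>c. c \<noteq> 0 \<and> y = c *s x)"
    then obtain c where c: "x \<noteq> 0" "y \<noteq> 0" "c \<noteq> 0" "y = c *s x" by blast
    then have "x = inverse c *s y" by (simp add: vector_smult_assoc)
    with c show "y \<noteq> 0 \<and> x \<noteq> 0 \<and> (\<exists>c. c \<noteq> 0 \<and> x = c *s y)"
      by (metis inverse_nonzero_iff_nonzero)
  qed
  show "transp (\<lambda>x y::complex ^ 'n. x \<noteq> 0 \<and> y \<noteq> 0 \<and> (\<exists>c. c \<noteq> 0 \<and> y = c *s x))"
    by (rule transpI) (metis vector_smult_assoc mult_eq_0_iff)
qed

text \<open>Homogeneous polynomials of degree \<open>d\<close>, as functions of the homogeneous coordinates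
  (no information is lost, the field of complex numbers being infinite).\<close>

definition form :: "nat \<Rightarrow> (complex ^ 'n::finite \<Rightarrow> complex) \<Rightarrow> bool" where
  "form d f \<longleftrightarrow> (\<exists>c :: ('n \<Rightarrow> nat) \<Rightarrow> complex.
     \<forall>x. f x = (\<Sum>\<alpha> | sum \<alpha> UNIV = d. c \<alpha> * (\<Prod>i\<in>UNIV. (x $ i) ^ \<alpha> i)))"

text \<open>Vanishing of a form at a point, and the value at a point of a quotient of two forms of the
  same degree, do not depend on the representative \<open>rep_proj p\<close> of the point \<open>p\<close>.\<close>

definition zariski :: "'n::finite proj topology" where
  "zariski = topology_generated_by {{p. f (rep_proj p) \<noteq> 0} | f d. form d f}"

definition irreducible_closed :: "'n::finite proj set \<Rightarrow> bool" where
  "irreducible_closed Z \<longleftrightarrow> closedin zariski Z \<and> Z \<noteq> {} \<and>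
     (\<forall>A B. closedin zariski A \<and> closedin zariski B \<and> Z \<subseteq> A \<union> B \<longrightarrow> Z \<subseteq> A \<or> Z \<subseteq> B)"

text \<open>Krull dimension: supremum of the lengths of chains of irreducible closed subsets.\<close>

definition zdim :: "'n::finite proj set \<Rightarrow> enat" where
  "zdim Z = Sup {enat m | m. \<exists>c. (\<forall>i\<le>m. irreducible_closed (c i) \<and> c i \<subseteq> Z) \<and>
                                (\<forall>i<m. c i \<subset> c (Suc i))}"

text \<open>Below, \<open>S\<close> is an irreducible closed set. Germs are represented by complex-valued functions
  that are given by a quotient of forms near the point in question and are arbitrary
  elsewhere; \<open>germ_eq\<close> identifies the representatives of the same germ.\<close>

definition regular_at :: "'n::finite proj set \<Rightarrow> 'n proj \<Rightarrow> ('n proj \<Rightarrow> complex) \<Rightarrow> bool" where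
  "regular_at S p \<phi> \<longleftrightarrow> (\<exists>U d a b. openin zariski U \<and> p \<in> U \<and> form d a \<and> form d b \<and>
     (\<forall>q\<in>U \<inter> S. b (rep_proj q) \<noteq> 0 \<and> \<phi> q = a (rep_proj q) / b (rep_proj q)))"

text \<open>The local ring of \<open>S\<close> along an irreducible closed subset \<open>Z\<close> of \<open>S\<close>: for \<open>Z = {p}\<close> the local
  ring at the point \<open>p\<close>, for a curve \<open>Z\<close> the local ring at its generic point, for \<open>Z = S\<close> the
  function field.\<close>

definition stalk :: "'n::finite proj set \<Rightarrow> 'n proj set \<Rightarrow> ('n proj \<Rightarrow> complex) set" where
  "stalk S Z = {\<phi>. \<exists>p\<in>Z. regular_at S p \<phi>}"

definition germ_eq ::
    "'n::finite proj set \<Rightarrow> 'n proj set \<Rightarrow> ('n proj \<Rightarrow> complex) \<Rightarrow> ('n proj \<Rightarrow> complex) \<Rightarrow> bool" where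
  "germ_eq S Z \<phi> \<psi> \<longleftrightarrow> (\<exists>U. openin zariski U \<and> U \<inter> Z \<noteq> {} \<and> (\<forall>q\<in>U \<inter> S. \<phi> q = \<psi> q))"

text \<open>The ideal, in the local ring of \<open>S\<close> along \<open>Z\<close>, of the germs vanishing on a closed set \<open>Y\<close>.\<close>

definition germ_ideal ::
    "'n::finite proj set \<Rightarrow> 'n proj set \<Rightarrow> 'n proj set \<Rightarrow> ('n proj \<Rightarrow> complex) set" where
  "germ_ideal S Z Y =
     {\<phi> \<in> stalk S Z. \<exists>U. openin zariski U \<and> U \<inter> Z \<noteq> {} \<and> (\<forall>q\<in>U \<inter> Y. \<phi> q = 0)}"

abbreviation max_ideal :: "'n::finite proj set \<Rightarrow> 'n proj set \<Rightarrow> ('n proj \<Rightarrow> complex) set" where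
  "max_ideal S Z \<equiv> germ_ideal S Z Z"

definition max_ideal_sq :: "'n::finite proj set \<Rightarrow> 'n proj set \<Rightarrow> ('n proj \<Rightarrow> complex) set" where
  "max_ideal_sq S Z = {\<phi> \<in> stalk S Z. \<exists>m f g.
     (\<forall>i<m::nat. f i \<in> max_ideal S Z \<and> g i \<in> max_ideal S Z) \<and>
     germ_eq S Z \<phi> (\<lambda>q. \<Sum>i<m. f i q * g i q)}"

text \<open>The dimension of the complex vector space \<open>V / W\<close>, as the least size of a spanning family.
  It is only used for finite-dimensional quotients. Whenever \<open>V\<close> and \<open>W\<close> consist of all
  representatives of certain germs, \<open>V / W\<close> is the corresponding quotient of spaces of germs,
  since \<open>W\<close> then contains all representatives of the zero germ.\<close>

definition quot_dim :: "('a \<Rightarrow> complex) set \<Rightarrow> ('a \<Rightarrow> complex) set \<Rightarrow> nat" where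
  "quot_dim V W = (LEAST d. \<exists>b. (\<forall>i<d. b i \<in> V) \<and>
     (\<forall>\<phi>\<in>V. \<exists>c. (\<lambda>q. \<phi> q - (\<Sum>i<d. c i * b i q)) \<in> W))"

text \<open>All local rings at points are regular: their Zariski cotangent space has the dimension of
  the variety.\<close>

definition nonsingular :: "'n::finite proj set \<Rightarrow> bool" where
  "nonsingular S \<longleftrightarrow> (\<forall>p\<in>S. enat (quot_dim (max_ideal S {p}) (max_ideal_sq S {p})) = zdim S)"

definition nonsingular_projective_surface :: "'n::finite proj set \<Rightarrow> bool" where
  "nonsingular_projective_surface S \<longleftrightarrow> irreducible_closed S \<and> zdim S = 2 \<and> nonsingular S"

definition curves :: "'n::finite proj set \<Rightarrow> 'n proj set set" where
  "curves S = {C. irreducible_closed C \<and> C \<subseteq> S \<and> zdim C = 1}"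

definition is_divisor :: "'n::finite proj set \<Rightarrow> ('n proj set \<Rightarrow>\<^sub>0 int) \<Rightarrow> bool" where
  "is_divisor S D \<longleftrightarrow> Poly_Mapping.keys D \<subseteq> curves S"

definition effective :: "'n::finite proj set \<Rightarrow> ('n proj set \<Rightarrow>\<^sub>0 int) \<Rightarrow> bool" where
  "effective S D \<longleftrightarrow> is_divisor S D \<and> (\<forall>C. Poly_Mapping.lookup D C \<ge> 0)"

definition uniformizer ::
    "'n::finite proj set \<Rightarrow> 'n proj set \<Rightarrow> ('n proj \<Rightarrow> complex) \<Rightarrow> bool" where
  "uniformizer S C t \<longleftrightarrow> t \<in> max_ideal S C \<and>
     (\<forall>\<psi>\<in>max_ideal S C. \<exists>\<rho>\<in>stalk S C. germ_eq S C \<psi> (\<lambda>q. \<rho> q * t q))"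

text \<open>Order of vanishing along the curve \<open>C\<close> of a nonzero rational function: on a nonsingular
  surface the local ring along \<open>C\<close> is a discrete valuation ring.\<close>

definition ord_along :: "'n::finite proj set \<Rightarrow> 'n proj set \<Rightarrow> ('n proj \<Rightarrow> complex) \<Rightarrow> int" where
  "ord_along S C \<phi> = (THE k. \<exists>t u. uniformizer S C t \<and> u \<in> stalk S C - max_ideal S C \<and>
     germ_eq S S \<phi> (\<lambda>q. u q * t q powi k))"

definition lin_equiv ::
    "'n::finite proj set \<Rightarrow> ('n proj set \<Rightarrow>\<^sub>0 int) \<Rightarrow> ('n proj set \<Rightarrow>\<^sub>0 int) \<Rightarrow> bool" where
  "lin_equiv S D E \<longleftrightarrow> (\<exists>\<phi>\<in>stalk S S. \<not> germ_eq S S \<phi> (\<lambda>_. 0) \<and>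
     (\<forall>C\<in>curves S. Poly_Mapping.lookup (D - E) C = ord_along S C \<phi>))"

text \<open>For distinct curves \<open>A\<close>, \<open>B\<close> and a point \<open>p\<close>, the dimension of the local ring at \<open>p\<close> modulo
  the sum of the ideals of \<open>A\<close> and \<open>B\<close>. On a nonsingular surface these ideals are generated by
  local equations \<open>f\<close>, \<open>g\<close> of the curves, so this is the usual dimension of the local ring
  modulo \<open>(f, g)\<close>.\<close>

definition local_mult :: "'n::finite proj set \<Rightarrow> 'n proj set \<Rightarrow> 'n proj set \<Rightarrow> 'n proj \<Rightarrow> nat" where
  "local_mult S A B p = quot_dim (stalk S {p})
     {\<lambda>q. f q + g q | f g. f \<in> germ_ideal S {p} A \<and> g \<in> germ_ideal S {p} B}"

definition proper_int :: "'n::finite proj set \<Rightarrow> 'n proj set \<Rightarrow> 'n proj set \<Rightarrow> int" where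
  "proper_int S A B = (\<Sum>p\<in>A \<inter> B. int (local_mult S A B p))"

text \<open>The self-intersection number of a curve \<open>C\<close>: replace one copy of \<open>C\<close> by a linearly equivalent
  divisor \<open>E\<close> not containing \<open>C\<close>. Such an \<open>E\<close> exists, and the result does not depend on it, because
  a nonzero rational function on a projective curve has degree zero.\<close>

definition self_int :: "'n::finite proj set \<Rightarrow> 'n proj set \<Rightarrow> int" where
  "self_int S C = (THE n. \<exists>E. is_divisor S E \<and> lin_equiv S E (frag_of C) \<and>
     C \<notin> Poly_Mapping.keys E \<and>
     n = (\<Sum>B\<in>Poly_Mapping.keys E. Poly_Mapping.lookup E B * proper_int S B C))"

definition curve_int :: "'n::finite proj set \<Rightarrow> 'n proj set \<Rightarrow> 'n proj set \<Rightarrow> int" where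
  "curve_int S A B = (if A = B then self_int S A else proper_int S A B)"

definition int_num ::
    "'n::finite proj set \<Rightarrow> ('n proj set \<Rightarrow>\<^sub>0 int) \<Rightarrow> ('n proj set \<Rightarrow>\<^sub>0 int) \<Rightarrow> int" where
  "int_num S D E = (\<Sum>A\<in>Poly_Mapping.keys D. \<Sum>B\<in>Poly_Mapping.keys E.
     Poly_Mapping.lookup D A * Poly_Mapping.lookup E B * curve_int S A B)"

definition nef :: "'n::finite proj set \<Rightarrow> ('n proj set \<Rightarrow>\<^sub>0 int) \<Rightarrow> bool" where
  "nef S D \<longleftrightarrow> (\<forall>C\<in>curves S. int_num S D (frag_of C) \<ge> 0)"

definition neg_curves :: "'n::finite proj set \<Rightarrow> ('n proj set \<Rightarrow>\<^sub>0 int) \<Rightarrow> 'n proj set set" where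
  "neg_curves S D = {C \<in> curves S. int_num S (frag_of C) (frag_of C) < 0 \<and>
                                   int_num S D (frag_of C) < 0}"

definition isoparametric ::
    "'n::finite proj set \<Rightarrow> ('n proj set \<Rightarrow>\<^sub>0 int) \<Rightarrow> ('n proj set \<Rightarrow>\<^sub>0 int)" where
  "isoparametric S D = D - (\<Sum>C\<in>neg_curves S D.
     frag_cmul \<lceil>of_int (int_num S (frag_of C) D) /
                (of_int (int_num S (frag_of C) (frag_of C)) :: rat)\<rceil> (frag_of C))"

end

theory Submission
  imports Defs
begin

text \<open>Intersection theory enters only through the shape of the intersection form: it is symmetric
  and distinct curves meet non-negatively. If \<open>D\<close> is effective and \<open>D \<cdot> C < 0\<close>, every contribution
  to \<open>D \<cdot> C\<close> from a component other than \<open>C\<close> is non-negative, so the contribution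
  \<open>D\<^sub>C C\<^sup>2\<close> of \<open>C\<close> itself is negative, where \<open>D\<^sub>C\<close> is the
  coefficient of \<open>C\<close>. Thus \<open>C\<close> is one of the finitely many components of \<open>D\<close>, and \<open>C\<^sup>2 < 0\<close>;
  in particular \<open>D\<close> is nef as soon as the transform has nothing to subtract.
  Dividing \<open>D\<^sub>C C\<^sup>2 \<le> D \<cdot> C < 0\<close> by the negative number \<open>C\<^sup>2\<close> gives \<open>0 < (D \<cdot> C) / C\<^sup>2 \<le> D\<^sub>C\<close>, so the
  integer subtracted from \<open>D\<^sub>C\<close> lies between \<open>1\<close> and \<open>D\<^sub>C\<close>
  (\<open>subtracted_multiplicity_bounds\<close>). Hence the transform keeps divisors effective, and unless \<open>D\<close>
  is nef it strictly decreases the sum of the coefficients, a natural number. The iteration therefore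
  reaches a nef divisor, and nef divisors are fixed.\<close>

section \<open>The intersection form on effective divisors\<close>

lemma local_mult_commute: "local_mult S A B p = local_mult S B A p"
proof -
  have "{\<lambda>q. f q + g q | f g. f \<in> germ_ideal S {p} A \<and> g \<in> germ_ideal S {p} B} \<subseteq>
        {\<lambda>q. f q + g q | f g. f \<in> germ_ideal S {p} B \<and> g \<in> germ_ideal S {p} A}" for A B
  proof
    fix h
    assume "h \<in> {\<lambda>q. f q + g q | f g. f \<in> germ_ideal S {p} A \<and> g \<in> germ_ideal S {p} B}"
    then obtain f g where "h = (\<lambda>q. f q + g q)" "f \<in> germ_ideal S {p} A" "g \<in> germ_ideal S {p} B"
      by blast
    moreover have "(\<lambda>q. f q + g q) = (\<lambda>q. g q + f q)" by (simp add: add.commute)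
    ultimately show "h \<in> {\<lambda>q. f q + g q | f g. f \<in> germ_ideal S {p} B \<and> g \<in> germ_ideal S {p} A}"
      by blast
  qed
  then show ?thesis unfolding local_mult_def by (intro arg_cong2[where f = quot_dim] equalityI refl)
qed

lemma curve_int_commute: "curve_int S A B = curve_int S B A"
proof -
  have "proper_int S A B = proper_int S B A"
    unfolding proper_int_def by (intro sum.cong) (auto simp: local_mult_commute[of S A B])
  then show ?thesis by (simp add: curve_int_def)
qed

text \<open>Needed because the transform is defined with \<open>C \<cdot> D\<close>, while nefness and the set of curves
  to subtract use \<open>D \<cdot> C\<close>.\<close>

lemma int_num_commute: "int_num S D E = int_num S E D"
proof -
  have "int_num S D E = (\<Sum>B\<in>Poly_Mapping.keys E. \<Sum>A\<in>Poly_Mapping.keys D.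
      Poly_Mapping.lookup D A * Poly_Mapping.lookup E B * curve_int S A B)"
    unfolding int_num_def by (rule sum.swap)
  also have "\<dots> = int_num S E D"
    unfolding int_num_def
    by (intro sum.cong refl) (metis curve_int_commute mult.commute)
  finally show ?thesis .
qed

lemma curve_int_nonneg: "A \<noteq> B \<Longrightarrow> curve_int S A B \<ge> 0"
  by (simp add: curve_int_def proper_int_def sum_nonneg)

lemma int_num_frag_of:
  "int_num S D (frag_of C) =
     (\<Sum>A\<in>Poly_Mapping.keys D. Poly_Mapping.lookup D A * curve_int S A C)"
  by (simp add: int_num_def)

lemma int_num_frag_of_frag_of: "int_num S (frag_of C) (frag_of C) = curve_int S C C"
  by (simp add: int_num_def)

text \<open>The terms left out belong to components distinct from \<open>C\<close>, so they are products of
  non-negative numbers.\<close>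

lemma self_contribution_le_int_num:
  assumes "effective S D"
  shows "Poly_Mapping.lookup D C * curve_int S C C \<le> int_num S D (frag_of C)"
proof -
  have "Poly_Mapping.lookup D C * curve_int S C C =
        (\<Sum>A\<in>Poly_Mapping.keys D \<inter> {C}. Poly_Mapping.lookup D A * curve_int S A C)"
    by (cases "C \<in> Poly_Mapping.keys D") (auto simp: in_keys_iff)
  also have "\<dots> \<le> int_num S D (frag_of C)"
    unfolding int_num_frag_of using assms
    by (intro sum_mono2) (auto simp: effective_def curve_int_nonneg)
  finally show ?thesis .
qed

lemma neg_int_num_imp_component:
  assumes "effective S D" "int_num S D (frag_of C) < 0"
  shows "Poly_Mapping.lookup D C > 0" "curve_int S C C < 0"
proof -
  have "Poly_Mapping.lookup D C * curve_int S C C < 0"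
    using self_contribution_le_int_num[OF assms(1), of C] assms(2) by linarith
  moreover have "Poly_Mapping.lookup D C \<ge> 0"
    using assms(1) by (simp add: effective_def)
  ultimately show "Poly_Mapping.lookup D C > 0" "curve_int S C C < 0"
    by (auto simp: mult_less_0_iff)
qed

section \<open>One step of the transform\<close>

lemma neg_curves_subset_keys:
  assumes "effective S D"
  shows "neg_curves S D \<subseteq> Poly_Mapping.keys D"
proof
  fix C
  assume "C \<in> neg_curves S D"
  then have "Poly_Mapping.lookup D C > 0"
    by (intro neg_int_num_imp_component(1)[OF assms]) (simp add: neg_curves_def)
  then show "C \<in> Poly_Mapping.keys D" by (simp add: in_keys_iff)
qed

lemma nef_if_no_neg_curves:
  assumes "effective S D" "neg_curves S D = {}"
  shows "nef S D"
  unfolding nef_def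
proof (intro ballI leI notI)
  fix C
  assume "C \<in> curves S" "int_num S D (frag_of C) < 0"
  then have "C \<in> neg_curves S D"
    using neg_int_num_imp_component(2)[OF assms(1), of C]
    by (simp only: neg_curves_def int_num_frag_of_frag_of mem_Collect_eq)
  with assms(2) show False by blast
qed

text \<open>The lower bound drives the descent; the upper bound keeps the transform effective.\<close>

lemma subtracted_multiplicity_bounds:
  assumes "effective S D" "C \<in> neg_curves S D"
  defines "m \<equiv> \<lceil>of_int (int_num S (frag_of C) D) /
                 (of_int (int_num S (frag_of C) (frag_of C)) :: rat)\<rceil>"
  shows "1 \<le> m" "m \<le> Poly_Mapping.lookup D C"
proof -
  let ?x = "of_int (int_num S D (frag_of C)) :: rat"
  let ?y = "of_int (curve_int S C C) :: rat"
  have m: "m = \<lceil>?x / ?y\<rceil>"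
    by (simp add: m_def int_num_commute[of S "frag_of C" D] int_num_frag_of_frag_of)
  have x: "?x < 0" and y: "?y < 0"
    using assms(2) by (auto simp: neg_curves_def int_num_frag_of_frag_of)
  have "?x / ?y > 0" using x y by (simp add: divide_neg_neg)
  then show "1 \<le> m" unfolding m by linarith
  have "of_int (Poly_Mapping.lookup D C) * ?y \<le> ?x"
    using self_contribution_le_int_num[OF assms(1), of C]
    by (metis of_int_le_iff of_int_mult)
  then have "?x / ?y \<le> of_int (Poly_Mapping.lookup D C)"
    using y by (simp add: neg_divide_le_eq)
  then show "m \<le> Poly_Mapping.lookup D C" unfolding m by (simp add: ceiling_le)
qed

lemma lookup_isoparametric:
  assumes "effective S D"
  shows "Poly_Mapping.lookup (isoparametric S D) C = Poly_Mapping.lookup D C -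
    (if C \<in> neg_curves S D
     then \<lceil>of_int (int_num S (frag_of C) D) /
           (of_int (int_num S (frag_of C) (frag_of C)) :: rat)\<rceil> else 0)"
proof -
  have "finite (neg_curves S D)"
    using neg_curves_subset_keys[OF assms] finite_keys finite_subset by blast
  then show ?thesis
    by (simp add: isoparametric_def lookup_minus lookup_sum if_distrib[of "times _"] cong: if_cong)
qed

lemma lookup_isoparametric_bounds:
  assumes "effective S D"
  shows "0 \<le> Poly_Mapping.lookup (isoparametric S D) C"
    and "Poly_Mapping.lookup (isoparametric S D) C \<le> Poly_Mapping.lookup D C"
    and "C \<in> neg_curves S D \<Longrightarrow>
           Poly_Mapping.lookup (isoparametric S D) C < Poly_Mapping.lookup D C"
proof -
  let ?m = "\<lceil>of_int (int_num S (frag_of C) D) /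
            (of_int (int_num S (frag_of C) (frag_of C)) :: rat)\<rceil>"
  have coeff: "Poly_Mapping.lookup (isoparametric S D) C =
    Poly_Mapping.lookup D C - (if C \<in> neg_curves S D then ?m else 0)"
    by (rule lookup_isoparametric[OF assms])
  have "0 \<le> Poly_Mapping.lookup D C" using assms by (simp add: effective_def)
  moreover have "1 \<le> ?m" "?m \<le> Poly_Mapping.lookup D C" if "C \<in> neg_curves S D"
    using subtracted_multiplicity_bounds[OF assms that] by blast+
  ultimately show "0 \<le> Poly_Mapping.lookup (isoparametric S D) C"
    and "Poly_Mapping.lookup (isoparametric S D) C \<le> Poly_Mapping.lookup D C"
    and "C \<in> neg_curves S D \<Longrightarrow>
           Poly_Mapping.lookup (isoparametric S D) C < Poly_Mapping.lookup D C"
    unfolding coeff by (smt (verit))+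
qed

lemma keys_isoparametric_subset:
  assumes "effective S D"
  shows "Poly_Mapping.keys (isoparametric S D) \<subseteq> Poly_Mapping.keys D"
  using lookup_isoparametric_bounds(1,2)[OF assms]
  by (metis in_keys_iff order_antisym subsetI)

lemma effective_isoparametric: "effective S D \<Longrightarrow> effective S (isoparametric S D)"
  using keys_isoparametric_subset lookup_isoparametric_bounds(1)
  unfolding effective_def is_divisor_def by blast

lemma isoparametric_fixed: "neg_curves S D = {} \<Longrightarrow> isoparametric S D = D"
  by (simp add: isoparametric_def)

section \<open>Descent on the sum of the coefficients\<close>

definition coeff_sum :: "('a \<Rightarrow>\<^sub>0 int) \<Rightarrow> nat" where
  "coeff_sum D = nat (\<Sum>C\<in>Poly_Mapping.keys D. Poly_Mapping.lookup D C)"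

lemma coeff_sum_isoparametric_less:
  assumes "effective S D" "neg_curves S D \<noteq> {}"
  shows "coeff_sum (isoparametric S D) < coeff_sum D"
proof -
  let ?E = "isoparametric S D"
  obtain C where C: "C \<in> neg_curves S D" using assms(2) by blast
  have "(\<Sum>A\<in>Poly_Mapping.keys ?E. Poly_Mapping.lookup ?E A) =
        (\<Sum>A\<in>Poly_Mapping.keys D. Poly_Mapping.lookup ?E A)"
    using keys_isoparametric_subset[OF assms(1)]
    by (intro sum.mono_neutral_left) (auto simp: in_keys_iff)
  also have "\<dots> < (\<Sum>A\<in>Poly_Mapping.keys D. Poly_Mapping.lookup D A)"
    using C neg_curves_subset_keys[OF assms(1)] lookup_isoparametric_bounds(2,3)[OF assms(1)]
    by (intro sum_strict_mono_ex1) auto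
  finally have "(\<Sum>A\<in>Poly_Mapping.keys ?E. Poly_Mapping.lookup ?E A) <
    (\<Sum>A\<in>Poly_Mapping.keys D. Poly_Mapping.lookup D A)" .
  moreover have "0 \<le> (\<Sum>A\<in>Poly_Mapping.keys ?E. Poly_Mapping.lookup ?E A)"
    by (intro sum_nonneg lookup_isoparametric_bounds(1)[OF assms(1)])
  ultimately show ?thesis by (simp add: coeff_sum_def)
qed

lemma iterate_reaches_no_neg_curves:
  assumes "effective S D"
  shows "\<exists>N. effective S ((isoparametric S ^^ N) D) \<and>
             neg_curves S ((isoparametric S ^^ N) D) = {}"
  using assms
proof (induction "coeff_sum D" arbitrary: D rule: less_induct)
  case less
  show ?case
  proof (cases "neg_curves S D = {}")
    case True
    then show ?thesis using less.prems by (intro exI[of _ 0]) simp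
  next
    case False
    then obtain N where "effective S ((isoparametric S ^^ N) (isoparametric S D))"
      "neg_curves S ((isoparametric S ^^ N) (isoparametric S D)) = {}"
      using less.hyps coeff_sum_isoparametric_less effective_isoparametric less.prems by blast
    then show ?thesis by (intro exI[of _ "Suc N"]) (simp add: funpow_swap1)
  qed
qed

theorem theorem1p2:
  fixes S :: "'n::finite proj set" and D :: "'n proj set \<Rightarrow>\<^sub>0 int"
  assumes "nonsingular_projective_surface S" and "effective S D"
  shows "\<exists>N. nef S ((isoparametric S ^^ N) D) \<and>
             (\<forall>k\<ge>N. (isoparametric S ^^ k) D = (isoparametric S ^^ N) D)"
proof -
  obtain N where eff: "effective S ((isoparametric S ^^ N) D)"
    and none: "neg_curves S ((isoparametric S ^^ N) D) = {}"
    using iterate_reaches_no_neg_curves[OF assms(2)] by blast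
  have "(isoparametric S ^^ k) D = (isoparametric S ^^ N) D" if "N \<le> k" for k
    using that by (induction k rule: dec_induct) (simp_all add: isoparametric_fixed[OF none])
  then show ?thesis using nef_if_no_neg_curves[OF eff none] by blast
qed

end
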